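(* Let $G$ be a bipartite graph with $q$ edges and stable sets $A_G,B_G$ that admits a bigraceful labeling $(f_{A_G},f_{B_G})$ with respect to the ordered partition $(A_G,B_G)$; identify each vertex of $A_G$ with its label under $f_{A_G}$ and each vertex of $B_G$ with its label under $f_{B_G}$. Let $n\ge1$ and let $A,B\subset[0,n-1]$ be fixed sets. Let $\Gamma$ be a family of bipartite graphs such that every $F\in\Gamma$ has exactly $n$ edges and admits a bigraceful labeling $(f_{A_F},f_{B_F})$ with respect to an ordered partition $(A_F,B_F)$ of $V(F)$ into stable sets, with $f_{A_F}(A_F)=A$ and $f_{B_F}(B_F)=B$, where $A$ and $B$ do not depend on $F$; identify the vertices of $A_F$ (resp. $B_F$) with their labels, so that every $F\in\Gamma$ has stable sets (copies of) $A$ and $B$. Let $h:E(G)\to\Gamma$ be any function. Then the graph $G\bar\otimes_h\Gamma$ admits a bigraceful labeling.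
   Context: Let $G$ be a bipartite graph with $m$ edges and stable sets $A,B$. A bigraceful labeling of $G$ (with respect to the ordered partition $(A,B)$) is a pair of injective functions $f_A:A\to[0,m-1]$, $f_B:B\to[0,m-1]$ such that the induced edge labeling $g(uv)=f_B(v)-f_A(u)$ ($u\in A$, $v\in B$) is an injective map $E(G)\to[0,m-1]$. The weak $\otimes_h$-product: given a bipartite graph $G$ with stable sets $A_G,B_G$, a family $\Gamma$ of bipartite graphs each with stable sets $A$ and $B$ (as disjoint vertex sets), and a function $h:E(G)\to\Gamma$, the graph $G\bar\otimes_h\Gamma$ has vertex set $(A_G\times A)\cup(B_G\times B)$ (the two parts regarded as disjoint), and $(a,x)\in A_G\times A$ is adjacent to $(b,y)\in B_G\times B$ if and only if $ab\in E(G)$ and $xy\in E(h(ab))$. *)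

theory Defs
  imports Main "HOL-Library.FuncSet"
begin

record 'v graph =
  verts :: "'v set"
  edges :: "'v set set"

definition simple_graph :: "'v graph \<Rightarrow> bool" where
  "simple_graph G \<longleftrightarrow> finite (verts G) \<and>
     (\<forall>e\<in>edges G. \<exists>u\<in>verts G. \<exists>v\<in>verts G. u \<noteq> v \<and> e = {u, v})"

definition stable_set :: "'v graph \<Rightarrow> 'v set \<Rightarrow> bool" where
  "stable_set G S \<longleftrightarrow> S \<subseteq> verts G \<and> (\<forall>u\<in>S. \<forall>v\<in>S. {u, v} \<notin> edges G)"

definition bipartite_graph :: "'v graph \<Rightarrow> 'v set \<Rightarrow> 'v set \<Rightarrow> bool" where
  "bipartite_graph G A B \<longleftrightarrow> simple_graph G \<and> A \<union> B = verts G \<and> A \<inter> B = {} \<and>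
     stable_set G A \<and> stable_set G B"

text \<open>In a bipartite graph with stable sets A and B every edge meets each of A and B in
  exactly one vertex, so the uses of \<^const>\<open>the_elem\<close> below pick out that vertex:
  the edge uv with u in A and v in B is labeled \<open>f\<^sub>B v - f\<^sub>A u\<close>.\<close>

definition induced_label ::
    "'v set \<Rightarrow> 'v set \<Rightarrow> ('v \<Rightarrow> int) \<Rightarrow> ('v \<Rightarrow> int) \<Rightarrow> 'v set \<Rightarrow> int" where
  "induced_label A B f\<^sub>A f\<^sub>B e = f\<^sub>B (the_elem (e \<inter> B)) - f\<^sub>A (the_elem (e \<inter> A))"

text \<open>Labels are integers, so that differences are not truncated and the interval is empty
  for a graph without edges.\<close>

definition bigraceful_labeling ::
    "'v graph \<Rightarrow> 'v set \<Rightarrow> 'v set \<Rightarrow> ('v \<Rightarrow> int) \<Rightarrow> ('v \<Rightarrow> int) \<Rightarrow> bool" where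
  "bigraceful_labeling G A B f\<^sub>A f\<^sub>B \<longleftrightarrow>
     bipartite_graph G A B \<and>
     (let I = {0 .. int (card (edges G)) - 1}; g = induced_label A B f\<^sub>A f\<^sub>B in
        inj_on f\<^sub>A A \<and> f\<^sub>A \<in> A \<rightarrow> I \<and>
        inj_on f\<^sub>B B \<and> f\<^sub>B \<in> B \<rightarrow> I \<and>
        inj_on g (edges G) \<and> g \<in> edges G \<rightarrow> I)"

text \<open>Identification of vertices with their labels. The same integer may label a vertex of
  each stable set, so the two sets of labels are kept apart by the sum type.\<close>

definition label_vertex ::
    "'v set \<Rightarrow> ('v \<Rightarrow> int) \<Rightarrow> ('v \<Rightarrow> int) \<Rightarrow> 'v \<Rightarrow> int + int" where
  "label_vertex A f\<^sub>A f\<^sub>B v = (if v \<in> A then Inl (f\<^sub>A v) else Inr (f\<^sub>B v))"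

definition identify_labels ::
    "'v graph \<Rightarrow> 'v set \<Rightarrow> ('v \<Rightarrow> int) \<Rightarrow> ('v \<Rightarrow> int) \<Rightarrow> (int + int) graph" where
  "identify_labels G A f\<^sub>A f\<^sub>B =
     \<lparr>verts = label_vertex A f\<^sub>A f\<^sub>B ` verts G,
      edges = (\<lambda>e. label_vertex A f\<^sub>A f\<^sub>B ` e) ` edges G\<rparr>"

text \<open>The weak product of G, with stable sets \<open>A\<^sub>G\<close> and \<open>B\<^sub>G\<close>, by a map h from its edges
  to a family of graphs that all have stable sets A and B. The two parts of the vertex set are
  disjoint because \<open>A\<^sub>G\<close> and \<open>B\<^sub>G\<close> are.\<close>

definition weak_product ::
    "'a graph \<Rightarrow> 'a set \<Rightarrow> 'a set \<Rightarrow> 'b set \<Rightarrow> 'b set \<Rightarrow> ('a set \<Rightarrow> 'b graph) \<Rightarrow> ('a \<times> 'b) graph" where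
  "weak_product G A\<^sub>G B\<^sub>G A B h =
     \<lparr>verts = (A\<^sub>G \<times> A) \<union> (B\<^sub>G \<times> B),
      edges = {{(a, x), (b, y)} | a x b y.
        a \<in> A\<^sub>G \<and> x \<in> A \<and> b \<in> B\<^sub>G \<and> y \<in> B \<and> {a, b} \<in> edges G \<and> {x, y} \<in> edges (h {a, b})}\<rparr>"

end

theory Submission
  imports Defs
begin

text \<open>The label of the vertex \<open>(a, x)\<close> is \<open>n * a + x\<close>, where \<open>a\<close> and \<open>x\<close> stand for labels. The edge
  over \<open>ab\<close> and \<open>xy\<close> is then labeled \<open>n * (b - a) + (y - x)\<close> with \<open>0 \<le> y - x < n\<close>, so its quotient
  by \<open>n\<close> determines the edge \<open>ab\<close> of G and its remainder determines the edge \<open>xy\<close> of \<open>h(ab)\<close>.\<close>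

text \<open>Recording an edge as an ordered pair of integers turns its induced label into the
  difference of the two components. The constructors \<open>Inl\<close> and \<open>Inr\<close> fix
  the order that the unordered edge lacks.\<close>

definition label_pairs :: "(int + int) graph \<Rightarrow> (int \<times> int) set" where
  "label_pairs G = {(i, j). {Inl i, Inr j} \<in> edges G}"

text \<open>Neither stable set can contain both ends of an edge, so each contains exactly one. The
  singleton intersections are what evaluates \<open>the_elem\<close> in
  \<open>induced_label\<close>.\<close>

lemma bipartite_graph_edgeE:
  assumes "bipartite_graph G A B" and "e \<in> edges G"
  obtains u v where "u \<in> A" "v \<in> B" "e = {u, v}" "e \<inter> A = {u}" "e \<inter> B = {v}"
proof -
  from assms obtain u v where uv: "u \<in> A \<union> B" "v \<in> A \<union> B" "e = {u, v}"
    unfolding bipartite_graph_def simple_graph_def by metis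
  have dj: "A \<inter> B = {}" using assms(1) by (simp add: bipartite_graph_def)
  have "\<not> (u \<in> A \<and> v \<in> A)" "\<not> (u \<in> B \<and> v \<in> B)"
    using assms uv(3) by (auto simp: bipartite_graph_def stable_set_def)
  then consider "u \<in> A" "v \<in> B" | "v \<in> A" "u \<in> B" using uv by auto
  then show thesis
  proof cases
    case 1
    then show thesis using that[of u v] uv(3) dj by auto
  next
    case 2
    then show thesis using that[of v u] uv(3) dj by auto
  qed
qed

lemma label_pairs_identify_labels:
  assumes "bipartite_graph G A B"
  shows "label_pairs (identify_labels G A f\<^sub>A f\<^sub>B) =
    (\<lambda>e. (f\<^sub>A (the_elem (e \<inter> A)), f\<^sub>B (the_elem (e \<inter> B)))) ` edges G" (is "_ = ?m ` _")
proof -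
  have image: "label_vertex A f\<^sub>A f\<^sub>B ` e = {Inl (fst (?m e)), Inr (snd (?m e))}"
    if e: "e \<in> edges G" for e
  proof -
    obtain u v where uv: "u \<in> A" "v \<in> B" "e = {u, v}" "e \<inter> A = {u}" "e \<inter> B = {v}"
      using bipartite_graph_edgeE[OF assms e] by metis
    have "v \<notin> A" using assms uv(2) by (auto simp: bipartite_graph_def)
    then have "label_vertex A f\<^sub>A f\<^sub>B ` e = {Inl (f\<^sub>A u), Inr (f\<^sub>B v)}"
      using uv(1,3) by (simp add: label_vertex_def insert_commute)
    then show ?thesis using uv(4,5) by simp
  qed
  have "p \<in> label_pairs (identify_labels G A f\<^sub>A f\<^sub>B) \<longleftrightarrow> (\<exists>e\<in>edges G. p = ?m e)" for p
  proof -
    have "p \<in> label_pairs (identify_labels G A f\<^sub>A f\<^sub>B) \<longleftrightarrow>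
        (\<exists>e\<in>edges G. {Inl (fst p), Inr (snd p)} = label_vertex A f\<^sub>A f\<^sub>B ` e)"
      by (auto simp: label_pairs_def identify_labels_def split: prod.splits)
    also have "\<dots> \<longleftrightarrow> (\<exists>e\<in>edges G. p = ?m e)"
      \<comment> \<open>The crossed way of matching two doubletons would equate an
        \<open>Inl\<close> with an \<open>Inr\<close>, so only the straight one survives.\<close>
      by (rule bex_cong[OF refl], subst image) (auto simp: doubleton_eq_iff prod_eq_iff)
    finally show ?thesis .
  qed
  then show ?thesis by auto
qed

text \<open>The induced label factors as the map from edges to label pairs followed by the
  difference. Injectivity of the composite gives injectivity of the first map, hence the
  cardinality, and of the difference on its image. This serves both for G and for the members of the
  family.\<close>

lemma bigraceful_label_pairs:
  assumes "bigraceful_labeling G A B f\<^sub>A f\<^sub>B"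
  defines "P \<equiv> label_pairs (identify_labels G A f\<^sub>A f\<^sub>B)"
  shows "P \<subseteq> f\<^sub>A ` A \<times> f\<^sub>B ` B" and "card P = card (edges G)" and "finite P"
    and "inj_on (\<lambda>(i, j). j - i) P"
    and "\<And>i j. (i, j) \<in> P \<Longrightarrow> 0 \<le> j - i \<and> j - i < int (card (edges G))"
proof -
  let ?m = "\<lambda>e. (f\<^sub>A (the_elem (e \<inter> A)), f\<^sub>B (the_elem (e \<inter> B)))"
  let ?d = "\<lambda>(i, j). j - i :: int"
  have bip: "bipartite_graph G A B"
    and inj: "inj_on (induced_label A B f\<^sub>A f\<^sub>B) (edges G)"
    and range: "induced_label A B f\<^sub>A f\<^sub>B \<in> edges G \<rightarrow> {0 .. int (card (edges G)) - 1}"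
    using assms(1) by (auto simp: bigraceful_labeling_def Let_def)
  have P: "P = ?m ` edges G" unfolding P_def by (rule label_pairs_identify_labels[OF bip])
  have comp: "induced_label A B f\<^sub>A f\<^sub>B = ?d \<circ> ?m" by (auto simp: induced_label_def)
  show "P \<subseteq> f\<^sub>A ` A \<times> f\<^sub>B ` B"
    unfolding P
  proof (rule image_subsetI)
    fix e assume "e \<in> edges G"
    then obtain u v where "u \<in> A" "v \<in> B" "e \<inter> A = {u}" "e \<inter> B = {v}"
      using bipartite_graph_edgeE[OF bip] by metis
    then show "?m e \<in> f\<^sub>A ` A \<times> f\<^sub>B ` B" by simp
  qed
  show "card P = card (edges G)"
    unfolding P by (rule card_image[OF inj_on_imageI2[OF inj[unfolded comp]]])
  show injd: "inj_on ?d P"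
    unfolding P using inj[unfolded comp] by (rule inj_on_imageI)
  show bound: "0 \<le> j - i \<and> j - i < int (card (edges G))" if "(i, j) \<in> P" for i j
    using that range by (auto simp: P induced_label_def Pi_iff)
  \<comment> \<open>The difference injects \<open>P\<close> into a bounded interval of integers,
    which makes \<open>P\<close> finite.\<close>
  have "?d ` P \<subseteq> {0 .. int (card (edges G)) - 1}" using bound by fastforce
  then show "finite P" using injd inj_on_finite by blast
qed

text \<open>Uniqueness of quotient and remainder on division by \<open>n\<close>, which is positive
  because \<open>0 \<le> x < n\<close>.\<close>

lemma int_mult_add_eq_iff:
  fixes n a b x y :: int
  assumes "0 \<le> x" "x < n" "0 \<le> y" "y < n"
  shows "n * a + x = n * b + y \<longleftrightarrow> a = b \<and> x = y"
proof
  assume *: "n * a + x = n * b + y"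
  have "(n * a + x) div n = a" "(n * b + y) div n = b" using assms by auto
  with * show "a = b \<and> x = y" by auto
qed simp

text \<open>The extreme case is \<open>a = q - 1\<close> and \<open>x = n - 1\<close>, which gives
  exactly \<open>q * n - 1\<close>.\<close>

lemma int_mult_add_bounds:
  fixes n q a x :: int
  assumes "0 \<le> a" "a < q" "0 \<le> x" "x < n"
  shows "0 \<le> n * a + x \<and> n * a + x \<le> q * n - 1"
proof -
  have "n * (a + 1) \<le> n * q" using assms by (intro mult_left_mono) auto
  then show ?thesis using assms by (auto simp: algebra_simps)
qed

theorem theorem6:
  fixes G :: "'a graph" and A\<^sub>G B\<^sub>G :: "'a set" and f\<^sub>A\<^sub>G f\<^sub>B\<^sub>G :: "'a \<Rightarrow> int" and q n :: nat
    and A B :: "int set"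
    and \<Gamma> :: "'b graph set"
    and A\<^sub>F B\<^sub>F :: "'b graph \<Rightarrow> 'b set" and f\<^sub>A\<^sub>F f\<^sub>B\<^sub>F :: "'b graph \<Rightarrow> 'b \<Rightarrow> int"
    and G' :: "(int + int) graph" and \<Gamma>' :: "(int + int) graph set"
    and h :: "(int + int) set \<Rightarrow> (int + int) graph"
  assumes "bipartite_graph G A\<^sub>G B\<^sub>G" and "card (edges G) = q"
    and "bigraceful_labeling G A\<^sub>G B\<^sub>G f\<^sub>A\<^sub>G f\<^sub>B\<^sub>G"
    and "n \<ge> 1" and "A \<subseteq> {0 .. int n - 1}" and "B \<subseteq> {0 .. int n - 1}"
    and "\<And>F. F \<in> \<Gamma> \<Longrightarrow> card (edges F) = n"
    and "\<And>F. F \<in> \<Gamma> \<Longrightarrow> bigraceful_labeling F (A\<^sub>F F) (B\<^sub>F F) (f\<^sub>A\<^sub>F F) (f\<^sub>B\<^sub>F F)"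
    and "\<And>F. F \<in> \<Gamma> \<Longrightarrow> f\<^sub>A\<^sub>F F ` A\<^sub>F F = A"
    and "\<And>F. F \<in> \<Gamma> \<Longrightarrow> f\<^sub>B\<^sub>F F ` B\<^sub>F F = B"
    and "G' = identify_labels G A\<^sub>G f\<^sub>A\<^sub>G f\<^sub>B\<^sub>G"
    and "\<Gamma>' = (\<lambda>F. identify_labels F (A\<^sub>F F) (f\<^sub>A\<^sub>F F) (f\<^sub>B\<^sub>F F)) ` \<Gamma>"
    and "h \<in> edges G' \<rightarrow> \<Gamma>'"
  shows "\<exists>p\<^sub>A p\<^sub>B. bigraceful_labeling
           (weak_product G' (Inl ` f\<^sub>A\<^sub>G ` A\<^sub>G) (Inr ` f\<^sub>B\<^sub>G ` B\<^sub>G) (Inl ` A) (Inr ` B) h)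
           ((Inl ` f\<^sub>A\<^sub>G ` A\<^sub>G) \<times> (Inl ` A)) ((Inr ` f\<^sub>B\<^sub>G ` B\<^sub>G) \<times> (Inr ` B)) p\<^sub>A p\<^sub>B"
proof (intro exI)
  let ?AP = "(Inl ` f\<^sub>A\<^sub>G ` A\<^sub>G) \<times> (Inl ` A) :: ((int + int) \<times> (int + int)) set"
  let ?BP = "(Inr ` f\<^sub>B\<^sub>G ` B\<^sub>G) \<times> (Inr ` B) :: ((int + int) \<times> (int + int)) set"
  let ?W = "weak_product G' (Inl ` f\<^sub>A\<^sub>G ` A\<^sub>G) (Inr ` f\<^sub>B\<^sub>G ` B\<^sub>G) (Inl ` A) (Inr ` B) h"
  define p\<^sub>A :: "(int + int) \<times> (int + int) \<Rightarrow> int"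
    where "p\<^sub>A = (\<lambda>(a, x). int n * projl a + projl x)"
  define p\<^sub>B :: "(int + int) \<times> (int + int) \<Rightarrow> int"
    where "p\<^sub>B = (\<lambda>(b, y). int n * projr b + projr y)"
  \<comment> \<open>\<open>E\<close> holds the base edges, and \<open>H p\<close> the edges of the
    graph that \<open>h\<close> assigns to the base edge \<open>p\<close>. The map
    \<open>edge\<close> assembles an edge of the product from one of each.\<close>
  define E where "E = label_pairs G'"
  define H where "H = (\<lambda>(i, j). label_pairs (h {Inl i, Inr j}))"
  define edge :: "(int \<times> int) \<times> (int \<times> int) \<Rightarrow> ((int + int) \<times> (int + int)) set"
    where "edge = (\<lambda>((i, j), (x, y)). {(Inl i, Inl x), (Inr j, Inr y)})"

  note E = bigraceful_label_pairs[OF assms(3), folded assms(11), folded E_def, unfolded assms(2)]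
  \<comment> \<open>The graph over \<open>p\<close> comes from some \<open>F\<close> depending on
    \<open>p\<close>, but \<open>A\<close>, \<open>B\<close> and \<open>n\<close> are common to the
    family, so these facts no longer mention \<open>F\<close>.\<close>
  have H: "H p \<subseteq> A \<times> B" "card (H p) = n" "finite (H p)" "inj_on (\<lambda>(i, j). j - i) (H p)"
    "\<And>x y. (x, y) \<in> H p \<Longrightarrow> 0 \<le> y - x \<and> y - x < int n" if "p \<in> E" for p
  proof -
    obtain i j where ij: "p = (i, j)" by (cases p)
    with that have "{Inl i, Inr j} \<in> edges G'" by (simp add: E_def label_pairs_def)
    then have "h {Inl i, Inr j} \<in> \<Gamma>'" using assms(13) by blast
    then obtain F where F: "F \<in> \<Gamma>"
      "h {Inl i, Inr j} = identify_labels F (A\<^sub>F F) (f\<^sub>A\<^sub>F F) (f\<^sub>B\<^sub>F F)"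
      using assms(12) by blast
    have Hp: "H p = label_pairs (identify_labels F (A\<^sub>F F) (f\<^sub>A\<^sub>F F) (f\<^sub>B\<^sub>F F))"
      using F(2) by (simp add: H_def ij)
    note * = bigraceful_label_pairs[OF assms(8)[OF F(1)], folded Hp,
        unfolded assms(7)[OF F(1)] assms(9)[OF F(1)] assms(10)[OF F(1)]]
    show "H p \<subseteq> A \<times> B" "card (H p) = n" "finite (H p)" "inj_on (\<lambda>(i, j). j - i) (H p)"
      "\<And>x y. (x, y) \<in> H p \<Longrightarrow> 0 \<le> y - x \<and> y - x < int n" by (fact *)+
  qed

  have edges: "edges ?W = edge ` Sigma E H"
  proof (intro set_eqI iffI)
    fix e assume "e \<in> edges ?W"
    then obtain i x j y where "e = edge ((i, j), (x, y))" "(i, j) \<in> E" "(x, y) \<in> H (i, j)"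
      by (auto simp: weak_product_def edge_def E_def H_def label_pairs_def)
    then show "e \<in> edge ` Sigma E H" by blast
  next
    fix e assume "e \<in> edge ` Sigma E H"
    then obtain i j x y where
      e: "e = edge ((i, j), (x, y))" "(i, j) \<in> E" "(x, y) \<in> H (i, j)" by auto
    moreover have "i \<in> f\<^sub>A\<^sub>G ` A\<^sub>G" "j \<in> f\<^sub>B\<^sub>G ` B\<^sub>G" "x \<in> A" "y \<in> B"
      using E(1) H(1)[OF e(2)] e by auto
    moreover have "{Inl i, Inr j} \<in> edges G'" "{Inl x, Inr y} \<in> edges (h {Inl i, Inr j})"
      using e by (auto simp: E_def H_def label_pairs_def)
    ultimately show "e \<in> edges ?W"
      unfolding weak_product_def edge_def graph.simps mem_Collect_eq e(1) prod.case
      by (intro exI[of _ "Inl i"] exI[of _ "Inl x"] exI[of _ "Inr j"] exI[of _ "Inr y"]) simp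
  qed
  \<comment> \<open>The end tagged \<open>Inl\<close> yields \<open>i\<close> and \<open>x\<close>,
    the end tagged \<open>Inr\<close> yields \<open>j\<close> and \<open>y\<close>. Thus the product
    has one edge for each element of \<open>Sigma E H\<close>, that is \<open>n\<close> edges over
    each of \<open>q\<close> base edges.\<close>
  have "inj_on edge (Sigma E H)"
  proof (rule inj_onI)
    fix s t assume "edge s = edge t"
    then show "s = t"
      by (cases s; cases t) (simp add: edge_def doubleton_eq_iff split: prod.splits)
  qed
  then have "card (edges ?W) = card (Sigma E H)"
    unfolding edges by (rule card_image)
  also have "\<dots> = (\<Sum>p\<in>E. card (H p))"
    using E(3) H(3) by (intro card_SigmaI) auto
  also have "\<dots> = (\<Sum>p\<in>E. n)"
    using H(2) by (intro sum.cong) auto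
  also have "\<dots> = q * n" using E(2) by simp
  finally have card: "card (edges ?W) = q * n" .

  have bip: "bipartite_graph G A\<^sub>G B\<^sub>G" by fact
  have "finite (f\<^sub>A\<^sub>G ` A\<^sub>G)" "finite (f\<^sub>B\<^sub>G ` B\<^sub>G)"
    using bip by (auto simp: bipartite_graph_def simple_graph_def intro: finite_subset)
  moreover have "finite A" "finite B"
    using assms(5,6) finite_subset by blast+
  ultimately have "finite (verts ?W)" by (simp add: weak_product_def)
  moreover have "\<exists>u\<in>verts ?W. \<exists>v\<in>verts ?W. u \<noteq> v \<and> e = {u, v}" if e: "e \<in> edges ?W" for e
  proof -
    obtain u v where uv: "e = {u, v}" "u \<in> ?AP" "v \<in> ?BP"
      using e unfolding weak_product_def graph.simps mem_Collect_eq by blast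
    then have "u \<noteq> v" by auto
    with uv show ?thesis unfolding weak_product_def graph.simps by blast
  qed
  moreover have "stable_set ?W ?AP" "stable_set ?W ?BP"
    by (auto simp: stable_set_def weak_product_def doubleton_eq_iff)
  moreover have "?AP \<union> ?BP = verts ?W" "?AP \<inter> ?BP = {}"
    by (auto simp: weak_product_def)
  ultimately have bipW: "bipartite_graph ?W ?AP ?BP"
    unfolding bipartite_graph_def simple_graph_def by blast

  have fAG: "0 \<le> f\<^sub>A\<^sub>G a \<and> f\<^sub>A\<^sub>G a < int q" if "a \<in> A\<^sub>G" for a
    using assms(2,3) that by (auto simp: bigraceful_labeling_def Let_def Pi_iff)
  have fBG: "0 \<le> f\<^sub>B\<^sub>G b \<and> f\<^sub>B\<^sub>G b < int q" if "b \<in> B\<^sub>G" for b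
    using assms(2,3) that by (auto simp: bigraceful_labeling_def Let_def Pi_iff)
  have A: "0 \<le> x \<and> x < int n" if "x \<in> A" for x using assms(5) that by auto
  have B: "0 \<le> y \<and> y < int n" if "y \<in> B" for y using assms(6) that by auto

  \<comment> \<open>The vertices are labels already, so recovering quotient and remainder recovers
    the vertex.\<close>
  have injA: "inj_on p\<^sub>A ?AP"
    using A by (auto simp: inj_on_def p\<^sub>A_def int_mult_add_eq_iff)
  have injB: "inj_on p\<^sub>B ?BP"
    using B by (auto simp: inj_on_def p\<^sub>B_def int_mult_add_eq_iff)
  have rangeA: "p\<^sub>A \<in> ?AP \<rightarrow> {0 .. int (q * n) - 1}"
    using A fAG int_mult_add_bounds[where q = "int q" and n = "int n"]
    by (auto simp: p\<^sub>A_def)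
  have rangeB: "p\<^sub>B \<in> ?BP \<rightarrow> {0 .. int (q * n) - 1}"
    using B fBG int_mult_add_bounds[where q = "int q" and n = "int n"]
    by (auto simp: p\<^sub>B_def)

  let ?g = "induced_label ?AP ?BP p\<^sub>A p\<^sub>B"
  have g: "?g (edge ((i, j), (x, y))) = int n * (j - i) + (y - x)"
    if "(i, j) \<in> E" "(x, y) \<in> H (i, j)" for i j x y
  proof -
    have "i \<in> f\<^sub>A\<^sub>G ` A\<^sub>G" "j \<in> f\<^sub>B\<^sub>G ` B\<^sub>G" "x \<in> A" "y \<in> B"
      using E(1) H(1)[OF that(1)] that by auto
    then have "edge ((i, j), (x, y)) \<inter> ?AP = {(Inl i, Inl x)}"
      "edge ((i, j), (x, y)) \<inter> ?BP = {(Inr j, Inr y)}"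
      by (auto simp: edge_def)
    then show ?thesis
      by (simp add: induced_label_def p\<^sub>A_def p\<^sub>B_def algebra_simps)
  qed
  have rangeg: "?g \<in> edges ?W \<rightarrow> {0 .. int (q * n) - 1}"
  proof
    fix e assume "e \<in> edges ?W"
    then obtain i j x y where e: "e = edge ((i, j), (x, y))" "(i, j) \<in> E" "(x, y) \<in> H (i, j)"
      unfolding edges by auto
    \<comment> \<open>Here \<open>j - i\<close> is the quotient, below \<open>q\<close> by the
      labeling of G, and \<open>y - x\<close> is the remainder, below \<open>n\<close> by the
      labeling of the graph over \<open>(i, j)\<close>.\<close>
    then show "?g e \<in> {0 .. int (q * n) - 1}"
      using int_mult_add_bounds[of "j - i" "int q" "y - x" "int n"] E(5)[OF e(2)] H(5)[OF e(2,3)]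
      by (simp add: g)
  qed
  have injg: "inj_on ?g (edges ?W)"
  proof (rule inj_onI)
    fix e e' assume "e \<in> edges ?W" "e' \<in> edges ?W" and eq: "?g e = ?g e'"
    then obtain i j x y i' j' x' y' where
      e: "e = edge ((i, j), (x, y))" "(i, j) \<in> E" "(x, y) \<in> H (i, j)" and
      e': "e' = edge ((i', j'), (x', y'))" "(i', j') \<in> E" "(x', y') \<in> H (i', j')"
      unfolding edges by auto
    have "j - i = j' - i' \<and> y - x = y' - x'"
      using eq H(5)[OF e(2,3)] H(5)[OF e'(2,3)] int_mult_add_eq_iff
      unfolding e(1) e'(1) g[OF e(2,3)] g[OF e'(2,3)] by blast
    \<comment> \<open>The base edge must be recovered first: only then do \<open>(x, y)\<close> and
      \<open>(x', y')\<close> lie in the same set \<open>H (i, j)\<close>, where the difference is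
      injective. Across different base edges equal differences prove nothing.\<close>
    moreover from this have ij: "(i, j) = (i', j')"
      using inj_onD[OF E(4), of "(i, j)" "(i', j')"] e(2) e'(2) by simp
    ultimately have "(x, y) = (x', y')"
      using inj_onD[OF H(4)[OF e(2)], of "(x, y)" "(x', y')"] e(3) e'(3) by simp
    with ij show "e = e'" by (simp add: e(1) e'(1))
  qed

  show "bigraceful_labeling ?W ?AP ?BP p\<^sub>A p\<^sub>B"
    unfolding bigraceful_labeling_def Let_def card
    using bipW injA injB rangeA rangeB injg rangeg by blast
qed

end
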